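(* For every integer $n$ with $n \geq 2$, $$\operatorname{bdim}(\mathcal{M}_{n,\,n^{n-1}}) = n.$$
   Context: A poset $P=(X,\leq)$ is a non-empty set $X$ (the ground set) with a reflexive, antisymmetric and transitive relation $\leq$. A linear order is a poset in which any two elements are comparable. For a linear order $L$ and elements $x,y$ of $L$, let $[x \leq_L y] \in \{0,1\}$ be $1$ if $x \leq y$ in $L$ and $0$ otherwise. For linear orders $L_1,\dots,L_d$ on the same ground set, write $[x \leq_{L_i} y]_{i=1}^d = ([x\leq_{L_1} y],\dots,[x \leq_{L_d} y]) \in \{0,1\}^d$. Boolean dimension: let $P$ be a poset with at least two elements and $d$ a nonnegative integer. A pair $((L_1,\dots,L_d),\phi)$, where $L_1,\dots,L_d$ are (arbitrary) linear orders on the ground set of $P$ and $\phi:\{0,1\}^d\to\{0,1\}$ is any map, is a Boolean realizer of $P$ of size $d$ if for every pair of elements $x,y$ of $P$: $x \leq y$ in $P$ if and only if $\phi([x\leq_{L_i} y]_{i=1}^d)=1$. The Boolean dimension $\operatorname{bdim}(P)$ is the minimum size of a Boolean realizer of $P$. For positive integers $n$ and $m$, $\mathcal{M}_{n,m}$ is the poset of all multisets with elements in $[n]=\{1,\dots,n\}$ in which every element has multiplicity less than $m$, ordered by inclusion; equivalently, $\{0,1,\dots,m-1\}^n$ with the coordinatewise order. In the claim, $m = n^{n-1}$. *)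

theory Defs
  imports "HOL-Library.Multiset" "HOL-Library.Extended_Nat"
begin

text \<open>
  A poset is given by its ground set \<open>X\<close> and its relation \<open>r\<close>, with \<open>partial_order_on X r\<close>.
  Vectors in \<open>{0,1}\<^sup>d\<close> are Boolean lists of length \<open>d\<close>; the values of \<open>\<phi>\<close> on lists of other
  lengths play no role.  The orders in \<open>Ls\<close> need not extend \<open>r\<close>.
\<close>

definition boolean_realizer ::
    "'a set \<Rightarrow> 'a rel \<Rightarrow> 'a rel list \<Rightarrow> (bool list \<Rightarrow> bool) \<Rightarrow> bool" where
  "boolean_realizer X r Ls \<phi> \<longleftrightarrow>
     (\<forall>L\<in>set Ls. linear_order_on X L) \<and>
     (\<forall>x\<in>X. \<forall>y\<in>X. (x, y) \<in> r \<longleftrightarrow> \<phi> (map (\<lambda>L. (x, y) \<in> L) Ls))"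

text \<open>
  The value is \<open>\<infinity>\<close> if there is no Boolean realizer of finite size; otherwise the infimum is
  attained.  Meaningful for posets with at least two elements.
\<close>

definition bdim :: "'a set \<Rightarrow> 'a rel \<Rightarrow> enat" where
  "bdim X r = Inf {enat (length Ls) | Ls \<phi>. boolean_realizer X r Ls \<phi>}"

definition bounded_msets :: "nat \<Rightarrow> nat \<Rightarrow> nat multiset set" where
  "bounded_msets n m = {A. set_mset A \<subseteq> {1..n} \<and> (\<forall>i. count A i < m)}"

definition bounded_msets_order :: "nat \<Rightarrow> nat \<Rightarrow> nat multiset rel" where
  "bounded_msets_order n m = {(A, B). A \<in> bounded_msets n m \<and> B \<in> bounded_msets n m \<and> A \<subseteq># B}"

lemma partial_order_on_bounded_msets_order:
  "partial_order_on (bounded_msets n m) (bounded_msets_order n m)"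
  unfolding partial_order_on_def preorder_on_def refl_on_def trans_def antisym_def
    bounded_msets_order_def
  by (auto intro: subset_mset.order_trans subset_mset.antisym)

end

theory Submission
  imports Defs "HOL-Library.Multiset_Order" "HOL-Library.FuncSet"
begin

text \<open>
  Write \<open>m = n ^ (n - 1)\<close>.  The upper bound is the one for the ordinary dimension: the multisets
  are compared lexicographically, with one order for each of the \<open>n\<close> multiplicities that may be
  compared first.

  The lower bound is a count.  Take a Boolean realizer of size \<open>d\<close> and a finite set \<open>Y\<close> of elements
  of the poset.  Each of its linear orders is cut by \<open>Y\<close> into at most \<open>card Y + 1\<close> intervals.  Two
  elements lying in the same interval of every order are in the same position relative to each
  \<open>y \<in> Y\<close>, so they lie below the same elements of \<open>Y\<close>.  Hence at most \<open>(card Y + 1) ^ d\<close> elements can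
  be told apart by which members of \<open>Y\<close> they lie below (lemma \<open>card_le_if_separated\<close>).  On the
  other hand a few elements suffice to separate the whole poset: a multiset is determined by the
  answers to the questions whether \<open>i\<close> has multiplicity at most \<open>k\<close>, for \<open>1 \<le> i \<le> n\<close> and
  \<open>k < m - 1\<close>, and each such question asks whether the multiset lies below a certain element
  (lemma \<open>subseteq_cap_iff\<close>).  These are at most \<open>n * (m - 1)\<close> elements, while the poset has
  \<open>m ^ n\<close>.  If \<open>d \<le> n - 1\<close>, then \<open>m ^ n \<le> (n * (m - 1) + 1) ^ (n - 1) < (n * m) ^ (n - 1)\<close>, and
  by the choice of \<open>m\<close> the last number is \<open>m ^ n\<close>, a contradiction.
\<close>

text \<open>
  The sets of upper bounds taken in \<open>Y\<close> with respect to a linear order form a chain under inclusion,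
  so their cardinality determines them.  This cardinality names the interval of the order, cut by
  \<open>Y\<close>, in which an element lies.
\<close>

lemma upper_bounds_eq_if_card_eq:
  assumes L: "linear_order_on X L" and "finite Y" "Y \<subseteq> X" "x \<in> X" "x' \<in> X"
    and card: "card {y \<in> Y. (x, y) \<in> L} = card {y \<in> Y. (x', y) \<in> L}"
  shows "{y \<in> Y. (x, y) \<in> L} = {y \<in> Y. (x', y) \<in> L}"
proof -
  have tr: "trans L" and tot: "total_on X L" and rf: "refl_on X L"
    using L by (auto simp: order_on_defs)
  have "(x, x') \<in> L \<or> (x', x) \<in> L"
    using tot rf \<open>x \<in> X\<close> \<open>x' \<in> X\<close> unfolding total_on_def refl_on_def by metis
  then show ?thesis
  proof
    assume "(x, x') \<in> L"
    then have "{y \<in> Y. (x', y) \<in> L} \<subseteq> {y \<in> Y. (x, y) \<in> L}"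
      using tr by (auto dest: transD)
    then show ?thesis
      using card \<open>finite Y\<close> by (intro card_subset_eq[symmetric]) auto
  next
    assume "(x', x) \<in> L"
    then have "{y \<in> Y. (x, y) \<in> L} \<subseteq> {y \<in> Y. (x', y) \<in> L}"
      using tr by (auto dest: transD)
    then show ?thesis
      using card \<open>finite Y\<close> by (intro card_subset_eq) auto
  qed
qed

text \<open>
  The interval containing an element is recorded for every order of the realizer.  Elements with
  equal records give \<open>\<phi>\<close> the same arguments against each \<open>y \<in> Y\<close>, so the map to records is
  injective on a set separated by \<open>Y\<close>.
\<close>

lemma card_le_if_separated:
  assumes R: "boolean_realizer X r Ls \<phi>" and "finite Y" "Y \<subseteq> X" "A \<subseteq> X"
    and sep: "\<And>x x'. \<lbrakk>x \<in> A; x' \<in> A; \<And>y. y \<in> Y \<Longrightarrow> (x, y) \<in> r \<longleftrightarrow> (x', y) \<in> r\<rbrakk> \<Longrightarrow> x = x'"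
  shows "card A \<le> (card Y + 1) ^ length Ls"
proof -
  define g where "g x = map (\<lambda>L. card {y \<in> Y. (x, y) \<in> L}) Ls" for x
  define T where "T = {ks. set ks \<subseteq> {..card Y} \<and> length ks = length Ls}"
  have "inj_on g A"
  proof (rule inj_onI)
    fix x x' assume x: "x \<in> A" "x' \<in> A" and eq: "g x = g x'"
    show "x = x'"
    proof (rule sep[OF x])
      fix y assume y: "y \<in> Y"
      have "(x, y) \<in> L \<longleftrightarrow> (x', y) \<in> L" if "L \<in> set Ls" for L
      proof -
        have "linear_order_on X L"
          using R that by (simp add: boolean_realizer_def)
        moreover have "card {y \<in> Y. (x, y) \<in> L} = card {y \<in> Y. (x', y) \<in> L}"
          using eq that by (simp add: g_def)
        ultimately have "{y \<in> Y. (x, y) \<in> L} = {y \<in> Y. (x', y) \<in> L}"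
          using x assms(2-4) by (intro upper_bounds_eq_if_card_eq[where X = X]) auto
        then show ?thesis using y by blast
      qed
      then have "map (\<lambda>L. (x, y) \<in> L) Ls = map (\<lambda>L. (x', y) \<in> L) Ls"
        by simp
      moreover have "(z, y) \<in> r \<longleftrightarrow> \<phi> (map (\<lambda>L. (z, y) \<in> L) Ls)" if "z \<in> A" for z
        using R that y assms(3,4) unfolding boolean_realizer_def by blast
      ultimately show "(x, y) \<in> r \<longleftrightarrow> (x', y) \<in> r"
        using x by metis
    qed
  qed
  moreover have "g ` A \<subseteq> T"
    using \<open>finite Y\<close> by (auto simp: g_def T_def intro!: card_mono)
  moreover have "finite T"
    unfolding T_def by (rule finite_lists_length_eq) simp
  ultimately have "card A \<le> card T"
    by (rule card_inj_on_le)
  also have "card T = (card Y + 1) ^ length Ls"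
    unfolding T_def by (simp add: card_lists_length_eq)
  finally show ?thesis .
qed

definition mset_of_mult :: "nat \<Rightarrow> (nat \<Rightarrow> nat) \<Rightarrow> nat multiset" where
  "mset_of_mult n f = (\<Sum>j\<in>{1..n}. replicate_mset (f j) j)"

lemma count_mset_of_mult: "count (mset_of_mult n f) i = (if i \<in> {1..n} then f i else 0)"
  by (auto simp: mset_of_mult_def count_sum)

lemma count_eq_0_if_bounded:
  assumes "A \<in> bounded_msets n m" "i \<notin> {1..n}"
  shows "count A i = 0"
  using assms by (auto simp: bounded_msets_def count_eq_zero_iff)

lemma mset_of_mult_in_bounded_msets:
  assumes "m > 0" "\<And>i. i \<in> {1..n} \<Longrightarrow> f i < m"
  shows "mset_of_mult n f \<in> bounded_msets n m"
proof -
  have "set_mset (mset_of_mult n f) \<subseteq> {1..n}"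
    using count_mset_of_mult[of n f] by (metis count_eq_zero_iff subsetI)
  then show ?thesis
    using assms by (simp add: bounded_msets_def count_mset_of_mult)
qed

lemma card_bounded_msets:
  assumes "m > 0"
  shows "card (bounded_msets n m) = m ^ n"
proof -
  have "bij_betw (mset_of_mult n) ({1..n} \<rightarrow>\<^sub>E {..<m}) (bounded_msets n m)"
  proof (rule bij_betw_byWitness[where f' = "\<lambda>A. restrict (count A) {1..n}"])
    show "\<forall>f\<in>{1..n} \<rightarrow>\<^sub>E {..<m}. restrict (count (mset_of_mult n f)) {1..n} = f"
      by (auto simp: count_mset_of_mult fun_eq_iff PiE_def extensional_def)
    show "\<forall>A\<in>bounded_msets n m. mset_of_mult n (restrict (count A) {1..n}) = A"
      by (auto simp: multiset_eq_iff count_mset_of_mult count_eq_0_if_bounded)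
    show "mset_of_mult n ` ({1..n} \<rightarrow>\<^sub>E {..<m}) \<subseteq> bounded_msets n m"
      using assms by (auto intro!: mset_of_mult_in_bounded_msets)
    show "(\<lambda>A. restrict (count A) {1..n}) ` bounded_msets n m \<subseteq> {1..n} \<rightarrow>\<^sub>E {..<m}"
      by (auto simp: bounded_msets_def)
  qed
  from bij_betw_same_card[OF this] show ?thesis
    by (simp add: card_PiE)
qed

definition cap :: "nat \<Rightarrow> nat \<Rightarrow> nat \<Rightarrow> nat \<Rightarrow> nat multiset" where
  "cap n m j k = mset_of_mult n (\<lambda>i. if i = j then k else m - 1)"

lemma cap_in_bounded_msets:
  assumes "k < m"
  shows "cap n m j k \<in> bounded_msets n m"
  unfolding cap_def using assms by (intro mset_of_mult_in_bounded_msets) auto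

text \<open>
  Only the multiplicity of \<open>j\<close> is constrained: in the cap all others have the largest value
  \<open>m - 1\<close> that occurs.
\<close>

lemma subseteq_cap_iff:
  assumes "A \<in> bounded_msets n m" "j \<in> {1..n}"
  shows "A \<subseteq># cap n m j k \<longleftrightarrow> count A j \<le> k"
proof
  assume "A \<subseteq># cap n m j k"
  then have "count A j \<le> count (cap n m j k) j"
    by (rule mset_subset_eq_count)
  then show "count A j \<le> k"
    using assms(2) by (simp add: cap_def count_mset_of_mult)
next
  assume k: "count A j \<le> k"
  have "count A i \<le> m - 1" for i
    using assms(1) by (auto simp: bounded_msets_def dest!: spec[of _ i])
  then show "A \<subseteq># cap n m j k"
    using k assms(1)
    by (auto simp: subseteq_mset_def cap_def count_mset_of_mult count_eq_0_if_bounded)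
qed

text \<open>
  The caps with \<open>k = m - 1\<close> lie above everything, hence separate nothing and are left out.  This saving
  keeps the base below \<open>n * m\<close>, which makes the final inequality strict.
\<close>

lemma card_bounded_msets_le_realizer:
  assumes "m > 0" and R: "boolean_realizer (bounded_msets n m) (bounded_msets_order n m) Ls \<phi>"
  shows "m ^ n \<le> (n * (m - 1) + 1) ^ length Ls"
proof -
  define Y where "Y = (\<lambda>(j, k). cap n m j k) ` ({1..n} \<times> {..<m - 1})"
  have Y: "Y \<subseteq> bounded_msets n m" "finite Y"
    unfolding Y_def by (auto intro!: cap_in_bounded_msets)
  have "card Y \<le> card ({1..n} \<times> {..<m - 1})"
    unfolding Y_def by (intro card_image_le) simp
  then have cardY: "card Y \<le> n * (m - 1)"
    by simp
  have sep: "A = B" if A: "A \<in> bounded_msets n m" and B: "B \<in> bounded_msets n m"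
    and same: "\<And>C. C \<in> Y \<Longrightarrow> (A, C) \<in> bounded_msets_order n m \<longleftrightarrow> (B, C) \<in> bounded_msets_order n m"
    for A B
  proof (rule multiset_eqI)
    fix i
    show "count A i = count B i"
    proof (cases "i \<in> {1..n}")
      case True
      have iff: "count A i \<le> k \<longleftrightarrow> count B i \<le> k" if "k < m - 1" for k
      proof -
        have "cap n m i k \<in> Y"
          using True that by (auto simp: Y_def)
        then have "A \<subseteq># cap n m i k \<longleftrightarrow> B \<subseteq># cap n m i k"
          using same[of "cap n m i k"] A B Y by (auto simp: bounded_msets_order_def)
        then show ?thesis
          using subseteq_cap_iff[OF A True] subseteq_cap_iff[OF B True] by simp
      qed
      have "count A i < m" "count B i < m"
        using A B by (auto simp: bounded_msets_def)
      then show ?thesis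
        using iff[of "count A i"] iff[of "count B i"] by linarith
    qed (use A B in \<open>simp add: count_eq_0_if_bounded\<close>)
  qed
  have "m ^ n = card (bounded_msets n m)"
    using assms(1) by (simp add: card_bounded_msets)
  also have "\<dots> \<le> (card Y + 1) ^ length Ls"
    using card_le_if_separated[OF R \<open>finite Y\<close> Y(1) subset_refl] sep by blast
  also have "\<dots> \<le> (n * (m - 1) + 1) ^ length Ls"
    using cardY by (intro power_mono) auto
  finally show ?thesis .
qed

lemma realizer_length_ge:
  assumes n: "n \<ge> 2" and m: "m = n ^ (n - 1)"
    and R: "boolean_realizer (bounded_msets n m) (bounded_msets_order n m) Ls \<phi>"
  shows "n \<le> length Ls"
proof (rule ccontr)
  assume "\<not> n \<le> length Ls"
  then have len: "length Ls \<le> n - 1" by simp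
  have "m > 0" using n m by simp
  then have "m ^ n \<le> (n * (m - 1) + 1) ^ length Ls"
    using R by (rule card_bounded_msets_le_realizer)
  also have "\<dots> \<le> (n * (m - 1) + 1) ^ (n - 1)"
    using len by (intro power_increasing) auto
  also have "\<dots> < (n * m) ^ (n - 1)"
  proof (rule power_strict_mono)
    show "n * (m - 1) + 1 < n * m"
      using n \<open>m > 0\<close> by (cases m) auto
  qed (use n in auto)
  also have "\<dots> = m * m ^ (n - 1)"
    using m by (simp add: power_mult_distrib)
  also have "\<dots> = m ^ n"
    using n by (cases n) auto
  finally show False by simp
qed

text \<open>
  The ties are broken by the multiset order, a linear order that extends inclusion, so that
  the resulting order extends inclusion too.
\<close>

definition coordinate_order :: "nat multiset set \<Rightarrow> nat \<Rightarrow> nat multiset rel" where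
  "coordinate_order X i =
     {(A, B). A \<in> X \<and> B \<in> X \<and> (count A i < count B i \<or> count A i = count B i \<and> A \<le> B)}"

lemma linear_order_on_coordinate_order: "linear_order_on X (coordinate_order X i)"
  unfolding order_on_defs refl_on_def trans_def antisym_def total_on_def coordinate_order_def
  by auto

lemma coordinate_orders_realize:
  "boolean_realizer (bounded_msets n m) (bounded_msets_order n m)
     (map (coordinate_order (bounded_msets n m)) [1..<Suc n]) (\<lambda>bs. False \<notin> set bs)"
proof -
  let ?X = "bounded_msets n m"
  have "A \<subseteq># B \<longleftrightarrow> (\<forall>i\<in>{1..n}. (A, B) \<in> coordinate_order ?X i)"
    if A: "A \<in> ?X" and B: "B \<in> ?X" for A B
  proof
    assume "A \<subseteq># B"
    then have "A \<le> B" "\<And>i. count A i \<le> count B i"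
      by (auto intro: subset_eq_imp_le_multiset mset_subset_eq_count)
    then show "\<forall>i\<in>{1..n}. (A, B) \<in> coordinate_order ?X i"
      using A B by (auto simp: coordinate_order_def order.order_iff_strict)
  next
    assume *: "\<forall>i\<in>{1..n}. (A, B) \<in> coordinate_order ?X i"
    have "count A i \<le> count B i" for i
    proof (cases "i \<in> {1..n}")
      case True
      with * have "(A, B) \<in> coordinate_order ?X i" by blast
      then show ?thesis by (auto simp: coordinate_order_def)
    qed (use A in \<open>simp add: count_eq_0_if_bounded\<close>)
    then show "A \<subseteq># B" by (simp add: subseteq_mset_def)
  qed
  then have "\<forall>A\<in>?X. \<forall>B\<in>?X. (A, B) \<in> bounded_msets_order n m \<longleftrightarrow>
      (\<forall>i\<in>{1..n}. (A, B) \<in> coordinate_order ?X i)"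
    by (simp add: bounded_msets_order_def)
  moreover have "set [1..<Suc n] = {1..n}"
    by auto
  ultimately show ?thesis
    unfolding boolean_realizer_def set_map map_map o_def
    by (auto simp: linear_order_on_coordinate_order simp del: upt_Suc)
qed

theorem proposition9:
  fixes n :: nat
  assumes "n \<ge> 2"
  shows "bdim (bounded_msets n (n ^ (n - 1))) (bounded_msets_order n (n ^ (n - 1))) = enat n"
proof (rule antisym)
  let ?m = "n ^ (n - 1)"
  let ?Ls = "map (coordinate_order (bounded_msets n ?m)) [1..<Suc n]"
  have "bdim (bounded_msets n ?m) (bounded_msets_order n ?m) \<le> enat (length ?Ls)"
    unfolding bdim_def using coordinate_orders_realize by (intro Inf_lower) blast
  then show "bdim (bounded_msets n ?m) (bounded_msets_order n ?m) \<le> enat n"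
    by (simp del: upt_Suc)
  show "enat n \<le> bdim (bounded_msets n ?m) (bounded_msets_order n ?m)"
    unfolding bdim_def using realizer_length_ge[OF assms refl] by (intro Inf_greatest) auto
qed

end
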